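(* Let $G$ and $H$ be finitely generated groups which are configuration equivalent, i.e. $\operatorname{Con}(G)=\operatorname{Con}(H)$. Suppose that $G$ contains a non-Abelian free subgroup of rank $n$, $n\in\mathbb N$. Then $H$ contains a non-Abelian free subgroup of rank $n$.
   Context: A configuration pair $(\mathfrak g,\mathcal E)$ of a finitely generated (discrete) group $G$ consists of an ordered generating set, i.e. a finite tuple $\mathfrak g=(g_1,\dots,g_n)$ of elements of $G$ whose entries generate $G$ as a group, and a finite partition $\mathcal E=\{E_1,\dots,E_m\}$ of $G$ with indexed blocks. A configuration corresponding to $(\mathfrak g,\mathcal E)$ is an $(n+1)$-tuple $C=(c_0,c_1,\dots,c_n)$ with $c_i\in\{1,\dots,m\}$ for which there exists $x\in E_{c_0}$ such that $g_ix\in E_{c_i}$ for each $i\in\{1,\dots,n\}$. The set of all of these is denoted $\operatorname{Con}(\mathfrak g,\mathcal E)$. $\operatorname{Con}(G)$ is the set of all sets $\operatorname{Con}(\mathfrak g,\mathcal E)$, where $(\mathfrak g,\mathcal E)$ ranges over all configuration pairs of $G$. Two groups $G,H$ are configuration equivalent, written $G\approx H$, if $\operatorname{Con}(G)=\operatorname{Con}(H)$. *)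

theory Defs
  imports "HOL-Algebra.Generated_Groups" "HOL-Library.Disjoint_Sets"
begin

definition finitely_generated_group :: "('a, 'b) monoid_scheme \<Rightarrow> bool" where
  "finitely_generated_group G \<longleftrightarrow>
     group G \<and> (\<exists>S. finite S \<and> S \<subseteq> carrier G \<and> generate G S = carrier G)"

section \<open>Configurations\<close>

text \<open>The pair \<open>(n, g)\<close> encodes the tuple \<open>(g 1, \<dots>, g n)\<close>, and \<open>(m, E)\<close> the indexed
  partition \<open>{E 1, \<dots>, E m}\<close>; values of \<open>g\<close> and \<open>E\<close> at other indices are irrelevant.
  Repetitions in the tuple are allowed, blocks are nonempty.\<close>

definition configuration_pair ::
  "('a, 'b) monoid_scheme \<Rightarrow> nat \<Rightarrow> (nat \<Rightarrow> 'a) \<Rightarrow> nat \<Rightarrow> (nat \<Rightarrow> 'a set) \<Rightarrow> bool" where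
  "configuration_pair G n g m E \<longleftrightarrow>
     g ` {1..n} \<subseteq> carrier G \<and> generate G (g ` {1..n}) = carrier G \<and>
     (\<Union>j\<in>{1..m}. E j) = carrier G \<and> disjoint_family_on E {1..m} \<and> (\<forall>j\<in>{1..m}. E j \<noteq> {})"

text \<open>A configuration \<open>(c\<^sub>0, \<dots>, c\<^sub>n)\<close> is a list of length \<open>n + 1\<close>, so that sets of
  configurations of groups over different types can be compared.\<close>

definition configurations ::
  "('a, 'b) monoid_scheme \<Rightarrow> nat \<Rightarrow> (nat \<Rightarrow> 'a) \<Rightarrow> nat \<Rightarrow> (nat \<Rightarrow> 'a set) \<Rightarrow> nat list set" where
  "configurations G n g m E =
     {c. length c = n + 1 \<and> set c \<subseteq> {1..m} \<and>
         (\<exists>x \<in> E (c ! 0). \<forall>i\<in>{1..n}. g i \<otimes>\<^bsub>G\<^esub> x \<in> E (c ! i))}"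

definition Con :: "('a, 'b) monoid_scheme \<Rightarrow> nat list set set" where
  "Con G = {configurations G n g m E | n g m E. configuration_pair G n g m E}"

definition configuration_equivalent ::
  "('a, 'b) monoid_scheme \<Rightarrow> ('c, 'd) monoid_scheme \<Rightarrow> bool" where
  "configuration_equivalent G H \<longleftrightarrow> Con G = Con H"

section \<open>Free groups\<close>

text \<open>The letter \<open>(True, x)\<close> stands for the generator \<open>x\<close>, and \<open>(False, x)\<close> for its inverse.\<close>

type_synonym 'x letter = "bool \<times> 'x"

fun inv_letter :: "'x letter \<Rightarrow> 'x letter" where
  "inv_letter (e, x) = (\<not> e, x)"

definition reduced :: "'x letter list \<Rightarrow> bool" where
  "reduced w \<longleftrightarrow> successively (\<lambda>a b. b \<noteq> inv_letter a) w"

fun push_letter :: "'x letter \<Rightarrow> 'x letter list \<Rightarrow> 'x letter list" where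
  "push_letter a [] = [a]"
| "push_letter a (b # w) = (if b = inv_letter a then w else a # b # w)"

definition reduce :: "'x letter list \<Rightarrow> 'x letter list" where
  "reduce w = foldr push_letter w []"

text \<open>The free group with basis \<open>A\<close>: reduced words over \<open>A\<close> and the inverses of its elements,
  multiplied by concatenation and cancellation.\<close>

definition free_group :: "'x set \<Rightarrow> 'x letter list monoid" where
  "free_group A =
     \<lparr>carrier = {w. set w \<subseteq> UNIV \<times> A \<and> reduced w},
      monoid.mult = (\<lambda>u v. reduce (u @ v)),
      one = []\<rparr>"

text \<open>A subgroup \<open>K\<close> of a group is itself a group, so \<open>\<not> comm_group\<close> says exactly that \<open>K\<close> is
  non-Abelian; this excludes \<open>n = 0\<close> and \<open>n = 1\<close>.\<close>

definition has_nonabelian_free_subgroup :: "('a, 'b) monoid_scheme \<Rightarrow> nat \<Rightarrow> bool" where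
  "has_nonabelian_free_subgroup G n \<longleftrightarrow>
     (\<exists>K. subgroup K G \<and> \<not> comm_group (G\<lparr>carrier := K\<rparr>) \<and>
          G\<lparr>carrier := K\<rparr> \<cong> free_group {1..n})"

lemma inv_letter_inv_letter [simp]: "inv_letter (inv_letter a) = a"
  by (cases a) simp

lemma inv_letter_neq [simp]: "inv_letter a \<noteq> a" "a \<noteq> inv_letter a"
  by (cases a; simp)+

lemma reduced_Nil [simp]: "reduced []"
  by (simp add: reduced_def)

lemma reduced_Cons:
  "reduced (a # w) \<longleftrightarrow> reduced w \<and> (w \<noteq> [] \<longrightarrow> hd w \<noteq> inv_letter a)"
  by (cases w) (auto simp: reduced_def)

lemma reduced_push_letter: "reduced w \<Longrightarrow> reduced (push_letter a w)"
  by (cases w) (auto simp: reduced_Cons)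

lemma push_letter_cancel:
  "reduced w \<Longrightarrow> push_letter (inv_letter a) (push_letter a w) = w"
  "reduced w \<Longrightarrow> push_letter a (push_letter (inv_letter a) w) = w"
  by (cases w; cases "tl w"; auto simp: reduced_Cons)+

lemma reduced_foldr_push: "reduced w \<Longrightarrow> reduced (foldr push_letter u w)"
  by (induction u) (auto intro: reduced_push_letter)

lemma reduced_reduce: "reduced (reduce w)"
  by (simp add: reduce_def reduced_foldr_push)

lemma reduce_reduced: "reduced w \<Longrightarrow> reduce w = w"
proof (induction w)
  case (Cons a w)
  then show ?case by (cases w) (auto simp: reduce_def reduced_Cons)
qed (simp add: reduce_def)

lemma foldr_push_push:
  assumes "reduced w"
  shows "foldr push_letter (push_letter a u) w = push_letter a (foldr push_letter u w)"
  using assms by (cases u) (auto simp: push_letter_cancel reduced_foldr_push)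

lemma foldr_push_reduce:
  "reduced w \<Longrightarrow> foldr push_letter (reduce u) w = foldr push_letter u w"
  by (induction u) (auto simp: reduce_def foldr_push_push)

lemma reduce_append: "reduce (u @ v) = foldr push_letter u (reduce v)"
  by (simp add: reduce_def)

lemma set_push_letter: "set (push_letter a w) \<subseteq> insert a (set w)"
  by (cases w) auto

lemma set_reduce: "set (reduce w) \<subseteq> set w"
proof (induction w)
  case (Cons a w)
  then show ?case
    using set_push_letter[of a "reduce w"] by (auto simp: reduce_def)
qed (simp add: reduce_def)

lemma reduce_inverse:
  "reduced u \<Longrightarrow> foldr push_letter (rev (map inv_letter u)) u = []"
proof (induction u)
  case (Cons a u)
  then show ?case by (auto simp: reduced_Cons)
qed simp

lemma group_free_group: "group (free_group A)"
proof (rule groupI)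
  fix u v
  assume "u \<in> carrier (free_group A)" "v \<in> carrier (free_group A)"
  then show "u \<otimes>\<^bsub>free_group A\<^esub> v \<in> carrier (free_group A)"
    using set_reduce[of "u @ v"] by (auto simp: free_group_def reduced_reduce)
next
  fix u v w
  assume "w \<in> carrier (free_group A)"
  then have w: "reduce w = w" "reduced w"
    by (auto simp: free_group_def reduce_reduced)
  have "reduce (reduce (u @ v) @ w) = foldr push_letter (u @ v) w"
    by (subst reduce_append) (simp only: w foldr_push_reduce[OF w(2)])
  also have "\<dots> = reduce (u @ reduce (v @ w))"
    using w by (simp add: reduce_append reduce_reduced reduced_foldr_push)
  finally show "u \<otimes>\<^bsub>free_group A\<^esub> v \<otimes>\<^bsub>free_group A\<^esub> w =
      u \<otimes>\<^bsub>free_group A\<^esub> (v \<otimes>\<^bsub>free_group A\<^esub> w)"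
    by (simp add: free_group_def)
next
  fix u
  assume u: "u \<in> carrier (free_group A)"
  let ?v = "reduce (rev (map inv_letter u))"
  have "set (rev (map inv_letter u)) \<subseteq> UNIV \<times> A"
    using u by (auto simp: free_group_def)
  then have "?v \<in> carrier (free_group A)"
    using set_reduce[of "rev (map inv_letter u)"] by (auto simp: free_group_def reduced_reduce)
  moreover have "?v \<otimes>\<^bsub>free_group A\<^esub> u = \<one>\<^bsub>free_group A\<^esub>"
    using u by (simp add: free_group_def reduce_append reduce_reduced foldr_push_reduce
        reduce_inverse)
  ultimately show "\<exists>v\<in>carrier (free_group A). v \<otimes>\<^bsub>free_group A\<^esub> u = \<one>\<^bsub>free_group A\<^esub>"
    by blast
qed (auto simp: free_group_def reduce_reduced)

end

theory Submission
  imports Defs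
begin

text \<open>A free subgroup of \<open>G\<close> with basis \<open>f\<^sub>1, \<dots>, f\<^sub>n\<close> acts freely on \<open>G\<close> by left multiplication, so
  a choice of coset representatives writes every element of \<open>G\<close> uniquely as a reduced word times
  a representative. Partition \<open>G\<close> into \<open>2n + 1\<close> blocks by the first letter of this word, with one
  extra block for the empty word, and include \<open>f\<^sub>1, \<dots>, f\<^sub>n\<close> in the generating tuple. The
  configurations record that \<open>f\<^sub>i\<close> maps the complement of the block of \<open>f\<^sub>i\<^sup>-\<^sup>1\<close> into the block of
  \<open>f\<^sub>i\<close>. A configuration pair of \<open>H\<close> with the same configurations has the same property, and
  ping-pong, started in the extra block, shows that the corresponding elements of \<open>H\<close> are a free
  basis of the subgroup that they generate.\<close>

section \<open>Ping-pong\<close>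

definition letter_eval :: "('a, 'b) monoid_scheme \<Rightarrow> ('x \<Rightarrow> 'a) \<Rightarrow> 'x letter \<Rightarrow> 'a" where
  "letter_eval G f a = (if fst a then f (snd a) else inv\<^bsub>G\<^esub> (f (snd a)))"

definition word_eval :: "('a, 'b) monoid_scheme \<Rightarrow> ('x \<Rightarrow> 'a) \<Rightarrow> 'x letter list \<Rightarrow> 'a" where
  "word_eval G f w = foldr (\<lambda>a x. letter_eval G f a \<otimes>\<^bsub>G\<^esub> x) w \<one>\<^bsub>G\<^esub>"

context group
begin

lemma letter_eval_closed:
  assumes "f ` A \<subseteq> carrier G" and "snd a \<in> A"
  shows "letter_eval G f a \<in> carrier G"
  using assms by (auto simp: letter_eval_def)

lemma letter_eval_inv_letter:
  assumes "f ` A \<subseteq> carrier G" and "snd a \<in> A"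
  shows "letter_eval G f (inv_letter a) = inv (letter_eval G f a)"
  using assms by (cases a) (auto simp: letter_eval_def image_subset_iff)

lemma word_eval_Nil: "word_eval G f [] = \<one>"
  by (simp add: word_eval_def)

lemma word_eval_Cons: "word_eval G f (a # w) = letter_eval G f a \<otimes> word_eval G f w"
  by (simp add: word_eval_def)

lemma word_eval_closed:
  assumes "f ` A \<subseteq> carrier G" and "set w \<subseteq> UNIV \<times> A"
  shows "word_eval G f w \<in> carrier G"
  using assms(2)
  by (induction w) (auto simp: word_eval_Nil word_eval_Cons letter_eval_closed[OF assms(1)])

lemma word_eval_append:
  assumes "f ` A \<subseteq> carrier G" and "set u \<subseteq> UNIV \<times> A" and "set v \<subseteq> UNIV \<times> A"
  shows "word_eval G f (u @ v) = word_eval G f u \<otimes> word_eval G f v"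
  using assms(2)
proof (induction u)
  case (Cons a u)
  then show ?case
    using word_eval_closed[OF assms(1)] letter_eval_closed[OF assms(1), of a] assms(3)
    by (auto simp: word_eval_Cons m_assoc)
qed (simp add: word_eval_Nil word_eval_closed[OF assms(1,3)])

lemma word_eval_push_letter:
  assumes "f ` A \<subseteq> carrier G" and "snd a \<in> A" and "set w \<subseteq> UNIV \<times> A"
  shows "word_eval G f (push_letter a w) = letter_eval G f a \<otimes> word_eval G f w"
proof (cases w)
  case (Cons b v)
  have "letter_eval G f a \<otimes> (letter_eval G f (inv_letter a) \<otimes> word_eval G f v) = word_eval G f v"
    using letter_eval_closed[OF assms(1,2)] word_eval_closed[OF assms(1), of v] assms(3) Cons
    by (simp add: letter_eval_inv_letter[OF assms(1,2)] m_assoc[symmetric])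
  then show ?thesis
    using Cons by (auto simp: word_eval_Cons)
qed (simp add: word_eval_Cons)

lemma word_eval_reduce:
  assumes "f ` A \<subseteq> carrier G" and "set w \<subseteq> UNIV \<times> A"
  shows "word_eval G f (reduce w) = word_eval G f w"
  using assms(2)
proof (induction w)
  case (Cons a w)
  have "word_eval G f (push_letter a (reduce w)) = letter_eval G f a \<otimes> word_eval G f (reduce w)"
    using Cons.prems set_reduce[of w] by (intro word_eval_push_letter[OF assms(1)]) auto
  with Cons show ?case
    by (simp add: word_eval_Cons) (simp add: reduce_def)
qed (simp add: reduce_def)

text \<open>Existence half of the universal property: cancelling a letter against its inverse does
  not change the value of a word, so the product of \<open>free_group A\<close> is
  respected.\<close>

lemma word_eval_hom:
  assumes "f ` A \<subseteq> carrier G"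
  shows "word_eval G f \<in> hom (free_group A) G"
  using assms
  by (intro homI)
    (auto simp: free_group_def word_eval_closed word_eval_reduce word_eval_append)

text \<open>Every nonempty reduced word moves \<open>y\<close> into the set \<open>D\<close> of its
  first letter. As \<open>y\<close> lies in none of these sets, no such word evaluates to the
  identity, so \<open>word_eval G f\<close> is injective and its image is the required
  subgroup.\<close>

lemma ping_pong:
  assumes f: "f ` A \<subseteq> carrier G"
    and D: "\<And>a b. \<lbrakk>snd a \<in> A; snd b \<in> A; a \<noteq> b\<rbrakk> \<Longrightarrow> D a \<inter> D b = {}"
    and move: "\<And>i x. \<lbrakk>i \<in> A; x \<in> carrier G; x \<notin> D (False, i)\<rbrakk> \<Longrightarrow> f i \<otimes> x \<in> D (True, i)"
    and y: "y \<in> carrier G" "\<And>a. snd a \<in> A \<Longrightarrow> y \<notin> D a"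
  shows "\<exists>K. subgroup K G \<and> G\<lparr>carrier := K\<rparr> \<cong> free_group A"
proof -
  have letter: "letter_eval G f a \<otimes> x \<in> D a"
    if a: "snd a \<in> A" and x: "x \<in> carrier G" "x \<notin> D (inv_letter a)" for a x
  proof (cases a)
    case (Pair e i)
    show ?thesis
    proof (cases e)
      case False
      \<comment> \<open>The hypothesis \<open>move\<close> concerns generators only; its
        contrapositive at \<open>inv f i \<otimes> x\<close> supplies the inverse letters.\<close>
      have "inv f i \<otimes> x \<in> D (False, i)"
      proof (rule ccontr)
        assume "inv f i \<otimes> x \<notin> D (False, i)"
        then have "f i \<otimes> (inv f i \<otimes> x) \<in> D (True, i)"
          using move[of i "inv f i \<otimes> x"] a x f Pair by auto
        moreover have "f i \<otimes> (inv f i \<otimes> x) = x"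
          using a x f Pair by (auto simp: m_assoc[symmetric] image_subset_iff)
        ultimately show False using x Pair False by simp
      qed
      then show ?thesis using Pair False by (simp add: letter_eval_def)
    qed (use move a x Pair in \<open>auto simp: letter_eval_def\<close>)
  qed
  have word: "word_eval G f w \<otimes> y \<in> D (hd w)"
    if "w \<noteq> []" "reduced w" "set w \<subseteq> UNIV \<times> A" for w
    using that
  proof (induction w)
    case (Cons a w)
    let ?x = "word_eval G f w \<otimes> y"
    have a: "snd a \<in> A" "snd (inv_letter a) \<in> A" using Cons.prems by (cases a; auto)+
    have w: "word_eval G f w \<in> carrier G" using Cons.prems f by (intro word_eval_closed) auto
    \<comment> \<open>If \<open>w\<close> is empty, \<open>?x\<close> is \<open>y\<close>, which
      avoids every \<open>D\<close>. Otherwise \<open>?x\<close> lies in \<open>D (hd w)\<close>,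
      where \<open>hd w\<close> is not \<open>inv_letter a\<close> because the word is reduced, and
      disjointness applies.\<close>
    have "?x \<notin> D (inv_letter a)"
    proof (cases "w = []")
      case True
      then show ?thesis using y a by (simp add: word_eval_Nil)
    next
      case False
      then have "?x \<in> D (hd w)" "hd w \<noteq> inv_letter a"
        using Cons by (auto simp: reduced_Cons)
      moreover have "snd (hd w) \<in> A"
        using hd_in_set[OF False] Cons.prems(3) by auto
      ultimately show ?thesis using D[of "hd w" "inv_letter a"] a by blast
    qed
    then have "letter_eval G f a \<otimes> ?x \<in> D a"
      using letter a w y by simp
    then show ?case
      using w y letter_eval_closed[OF f a(1)] by (simp add: word_eval_Cons m_assoc)
  qed simp
  interpret F: group_hom "free_group A" G "word_eval G f"
    using group_free_group[of A] is_group word_eval_hom[OF f]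
    by (simp add: group_hom_def group_hom_axioms_def)
  have "w = []" if "w \<in> carrier (free_group A)" "word_eval G f w = \<one>" for w
  proof (rule ccontr)
    assume "w \<noteq> []"
    have w: "reduced w" "set w \<subseteq> UNIV \<times> A"
      using that(1) by (auto simp: free_group_def)
    have "y \<in> D (hd w)"
      using word[OF \<open>w \<noteq> []\<close> w] that(2) y(1) by simp
    moreover have "snd (hd w) \<in> A"
      using hd_in_set[OF \<open>w \<noteq> []\<close>] w(2) by auto
    ultimately show False using y(2) by blast
  qed
  then have "inj_on (word_eval G f) (carrier (free_group A))"
    by (subst F.inj_on_one_iff) (auto simp: free_group_def)
  then have "word_eval G f \<in>
      iso (free_group A) (G\<lparr>carrier := word_eval G f ` carrier (free_group A)\<rparr>)"
    using word_eval_hom[OF f] by (auto simp: iso_def hom_def bij_betw_def)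
  then have "G\<lparr>carrier := word_eval G f ` carrier (free_group A)\<rparr> \<cong> free_group A"
    using F.G.iso_sym is_isoI by blast
  then show ?thesis using F.img_is_subgroup by blast
qed

section \<open>Coset representatives and an equivariant map onto the free group\<close>

text \<open>Fix a representative \<open>r x\<close> in each right coset of \<open>K\<close>. The
  factor \<open>x \<otimes> inv r x\<close> lies in \<open>K\<close>, and its preimage under
  \<open>\<phi>\<close> is \<open>p x\<close>. Left multiplication by an element of \<open>K\<close>
  keeps the coset, hence the representative, and only multiplies this factor.\<close>

lemma equivariant_map_onto_subgroup:
  assumes K: "subgroup K G" and F: "group F" and \<phi>: "\<phi> \<in> iso F (G\<lparr>carrier := K\<rparr>)"
  obtains p where "p ` carrier G = carrier F"
    and "\<And>u x. \<lbrakk>u \<in> carrier F; x \<in> carrier G\<rbrakk> \<Longrightarrow> p (\<phi> u \<otimes> x) = u \<otimes>\<^bsub>F\<^esub> p x"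
proof -
  interpret F: group F by (rule F)
  \<comment> \<open>The choice is made from the coset as a set, so \<open>r\<close> is constant on
    each coset.\<close>
  define r where "r x = (SOME z. z \<in> K #> x)" for x
  define p where "p x = inv_into (carrier F) \<phi> (x \<otimes> inv r x)" for x
  have \<phi>_K: "\<phi> u \<in> K" if "u \<in> carrier F" for u
    using \<phi> that by (auto simp: iso_def hom_def)
  have \<phi>_G: "\<phi> u \<in> carrier G" if "u \<in> carrier F" for u
    using \<phi>_K[OF that] subgroup.subset[OF K] by blast
  have \<phi>_mult: "\<phi> (u \<otimes>\<^bsub>F\<^esub> v) = \<phi> u \<otimes> \<phi> v" if "u \<in> carrier F" "v \<in> carrier F" for u v
    using \<phi> that by (auto simp: iso_def hom_def)
  have bij: "bij_betw \<phi> (carrier F) K"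
    using \<phi> by (simp add: iso_def)
  have r: "r x \<in> K #> x" if "x \<in> carrier G" for x
    unfolding r_def using rcos_self[OF that K] by (rule someI)
  have r_G: "r x \<in> carrier G" if "x \<in> carrier G" for x
    using r[OF that] r_coset_subset_G[OF subgroup.subset[OF K] that] by blast
  have r_eq: "r (\<phi> u \<otimes> x) = r x" if "u \<in> carrier F" "x \<in> carrier G" for u x
  proof -
    have "\<phi> u \<otimes> x \<in> K #> x"
      using \<phi>_K[OF that(1)] by (auto simp: r_coset_def)
    then show ?thesis
      using repr_independence[OF _ that(2) K] by (simp add: r_def)
  qed
  have p_eqI: "p x = u" if "u \<in> carrier F" "x \<in> carrier G" "x = \<phi> u \<otimes> r x" for u x
  proof -
    have "x \<otimes> inv r x = \<phi> u"
      using that \<phi>_G r_G by (metis inv_solve_right')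
    then show ?thesis
      using bij that(1) by (simp add: p_def bij_betw_def)
  qed
  have p: "p x \<in> carrier F" "x = \<phi> (p x) \<otimes> r x" if x: "x \<in> carrier G" for x
  proof -
    obtain k where k: "k \<in> K" "r x = k \<otimes> x" using r[OF x] by (auto simp: r_coset_def)
    then have kG: "k \<in> carrier G" using subgroup.subset[OF K] by blast
    have "inv k \<in> K" using K k by (simp add: subgroup.m_inv_closed)
    then obtain u where u: "u \<in> carrier F" "\<phi> u = inv k"
      using bij by (metis bij_betw_def imageE)
    have "x = \<phi> u \<otimes> r x" using u k kG x by (simp add: m_assoc[symmetric])
    then show "p x \<in> carrier F" "x = \<phi> (p x) \<otimes> r x" using p_eqI[OF u(1) x] u by simp_all
  qed
  have equivariant: "p (\<phi> u \<otimes> x) = u \<otimes>\<^bsub>F\<^esub> p x" if "u \<in> carrier F" "x \<in> carrier G" for u x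
  proof (rule p_eqI)
    have "\<phi> u \<otimes> x = \<phi> u \<otimes> (\<phi> (p x) \<otimes> r x)" using p(2)[OF that(2)] by simp
    also have "\<dots> = \<phi> (u \<otimes>\<^bsub>F\<^esub> p x) \<otimes> r x"
      using that p(1) \<phi>_G r_G by (simp add: \<phi>_mult m_assoc)
    finally show "\<phi> u \<otimes> x = \<phi> (u \<otimes>\<^bsub>F\<^esub> p x) \<otimes> r (\<phi> u \<otimes> x)"
      unfolding r_eq[OF that] .
  qed (use that p(1) \<phi>_G in auto)
  have "u \<in> p ` carrier G" if u: "u \<in> carrier F" for u
  proof -
    \<comment> \<open>The representative of \<open>K\<close> itself need not be
      \<open>\<one>\<close>, so \<open>p \<one>\<close> may be any element of \<open>F\<close>;
      dividing by it corrects the value.\<close>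
    define v where "v = u \<otimes>\<^bsub>F\<^esub> inv\<^bsub>F\<^esub> p \<one>"
    have v: "v \<in> carrier F" using u p(1)[OF one_closed] by (simp add: v_def)
    have "p (\<phi> v \<otimes> \<one>) = u"
      using equivariant[OF v one_closed] u p(1)[OF one_closed] by (simp add: v_def F.m_assoc)
    then show ?thesis using \<phi>_G[OF v] by force
  qed
  then have "p ` carrier G = carrier F" using p(1) by blast
  then show ?thesis using equivariant that by blast
qed

end

section \<open>Configurations\<close>

lemma configuration_pair_block_unique:
  assumes "configuration_pair G n g m E" and "i \<in> {1..m}" and "j \<in> {1..m}"
    and "x \<in> E i" and "x \<in> E j"
  shows "i = j"
proof (rule ccontr)
  assume "i \<noteq> j"
  then have "E i \<inter> E j = {}"
    using assms(1-3) by (intro disjoint_family_onD[of E "{1..m}"]) (auto simp: configuration_pair_def)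
  then show False using assms(4,5) by blast
qed

lemma configurations_nth:
  assumes "c \<in> configurations G n g m E" and "i \<le> n"
  shows "c ! i \<in> {1..m}"
proof -
  have "i < length c" "set c \<subseteq> {1..m}"
    using assms by (simp_all add: configurations_def)
  then show ?thesis using nth_mem by blast
qed

text \<open>The blocks cover the group, so every point realizes some configuration. Information
  about the set of configurations thereby becomes information about all points.\<close>

lemma configuration_exists:
  assumes "group G" and "configuration_pair G n g m E" and "x \<in> carrier G"
  obtains c where "c \<in> configurations G n g m E" "x \<in> E (c ! 0)"
    and "\<And>i. i \<in> {1..n} \<Longrightarrow> g i \<otimes>\<^bsub>G\<^esub> x \<in> E (c ! i)"
proof -
  interpret group G by fact
  have "\<exists>j. j \<in> {1..m} \<and> z \<in> E j" if "z \<in> carrier G" for z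
    using assms(2) that unfolding configuration_pair_def by blast
  then obtain b where b: "b z \<in> {1..m}" "z \<in> E (b z)" if "z \<in> carrier G" for z
    by metis
  \<comment> \<open>Position 0 records the block of \<open>x\<close> itself; \<open>g 0\<close> is
    not part of the tuple, hence the case distinction.\<close>
  define c where "c = map (\<lambda>i. b (if i = 0 then x else g i \<otimes>\<^bsub>G\<^esub> x)) [0..<n + 1]"
  have nth: "c ! i = b (if i = 0 then x else g i \<otimes>\<^bsub>G\<^esub> x)" if "i \<le> n" for i
    using that unfolding c_def by (subst nth_map) (auto simp del: upt_Suc)
  have g: "g i \<otimes>\<^bsub>G\<^esub> x \<in> carrier G" if "i \<in> {1..n}" for i
    using assms(2,3) that by (auto simp: configuration_pair_def image_subset_iff)
  have 0: "x \<in> E (c ! 0)" using b assms(3) nth[of 0] by simp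
  have i: "g i \<otimes>\<^bsub>G\<^esub> x \<in> E (c ! i)" if "i \<in> {1..n}" for i
    using b[OF g[OF that]] nth[of i] that by simp
  have "set c \<subseteq> {1..m}"
    using b(1) g assms(3) by (force simp: c_def simp del: upt_Suc)
  moreover have "length c = n + 1" by (simp add: c_def)
  ultimately have "c \<in> configurations G n g m E"
    unfolding configurations_def using 0 i by blast
  then show ?thesis using 0 i that by blast
qed

text \<open>Since no block is empty, every index occurs as a first entry, so \<open>m\<close> can be
  read off from the configurations.\<close>

lemma configurations_hd:
  assumes "group G" and "configuration_pair G n g m E"
  shows "(\<lambda>c. c ! 0) ` configurations G n g m E = {1..m}"
proof (intro equalityI subsetI)
  fix j assume j: "j \<in> {1..m}"
  then obtain x where x: "x \<in> E j" "x \<in> carrier G"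
    using assms(2) unfolding configuration_pair_def by blast
  obtain c where c: "c \<in> configurations G n g m E" "x \<in> E (c ! 0)"
    using configuration_exists[OF assms x(2)] by blast
  then have "c ! 0 = j"
    using configuration_pair_block_unique[OF assms(2) configurations_nth j] x(1) by blast
  then show "j \<in> (\<lambda>c. c ! 0) ` configurations G n g m E" using c(1) by blast
next
  fix j assume "j \<in> (\<lambda>c. c ! 0) ` configurations G n g m E"
  then show "j \<in> {1..m}" using configurations_nth by blast
qed

text \<open>The common length of the configurations gives the size of the tuple, and their first
  entries give the number of blocks. A configuration exists because the identity realizes
  one.\<close>

lemma configurations_sizes_eq:
  assumes "group G" and "configuration_pair G n g m E"
    and "group H" and "configuration_pair H n' h m' F"
    and eq: "configurations G n g m E = configurations H n' h m' F"
  shows "n' = n" and "m' = m"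
proof -
  interpret group G by fact
  obtain c where "c \<in> configurations G n g m E"
    using configuration_exists[OF assms(1,2) one_closed] by blast
  moreover from this have "c \<in> configurations H n' h m' F" using eq by simp
  ultimately show "n' = n" by (simp add: configurations_def)
  have "{1..m'} = {1..m}"
    using configurations_hd[OF assms(1,2)] configurations_hd[OF assms(3,4)] eq by simp
  from arg_cong[OF this, of card] show "m' = m" by simp
qed

section \<open>The partition by first letters\<close>

text \<open>Letters over \<open>{1..n}\<close> receive the indices from 2 to
  \<open>2 * n + 1\<close>; index 1 stays free for the empty word.\<close>

fun letter_index :: "nat letter \<Rightarrow> nat" where
  "letter_index (e, i) = (if e then 2 * i else 2 * i + 1)"

lemma inj_letter_index: "inj letter_index"
  by (rule injI) (auto split: if_splits prod.splits elim!: letter_index.elims, presburger+)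

definition first_index :: "nat letter list \<Rightarrow> nat" where
  "first_index w = (if w = [] then 1 else letter_index (hd w))"

lemma letter_index_range:
  "letter_index ` (UNIV \<times> {1..n}) = {2..2 * n + 1}"
proof (intro equalityI subsetI)
  fix j assume j: "j \<in> {2..2 * n + 1}"
  then have "letter_index (even j, j div 2) = j" "j div 2 \<in> {1..n}" by auto
  then show "j \<in> letter_index ` (UNIV \<times> {1..n})" by (metis UNIV_I image_eqI mem_Sigma_iff)
qed auto

text \<open>Every value is attained, by the empty word or by a one-letter word; this later makes all
  blocks nonempty.\<close>

lemma first_index_range:
  "first_index ` carrier (free_group {1..n}) = {1..2 * n + 1}"
proof (intro equalityI subsetI)
  fix j assume "j \<in> first_index ` carrier (free_group {1..n})"
  then obtain w where w: "set w \<subseteq> UNIV \<times> {1..n}" "j = first_index w"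
    by (auto simp: free_group_def)
  show "j \<in> {1..2 * n + 1}"
  proof (cases "w = []")
    case False
    then have "letter_index (hd w) \<in> {2..2 * n + 1}"
      using w(1) hd_in_set letter_index_range[of n] by blast
    then show ?thesis using w(2) False by (simp add: first_index_def)
  qed (simp add: w first_index_def)
next
  fix j assume j: "j \<in> {1..2 * n + 1}"
  show "j \<in> first_index ` carrier (free_group {1..n})"
  proof (cases "j = 1")
    case True
    then show ?thesis by (auto simp: first_index_def free_group_def intro!: image_eqI[of _ _ "[]"])
  next
    case False
    then have "j \<in> letter_index ` (UNIV \<times> {1..n})"
      using j unfolding letter_index_range by auto
    then obtain a where "a \<in> UNIV \<times> {1..n}" "j = letter_index a" by blast
    then show ?thesis
      by (intro image_eqI[of _ _ "[a]"]) (auto simp: first_index_def free_group_def reduced_Cons)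
  qed
qed

text \<open>Cancellation can occur only if \<open>w\<close> begins with the inverse letter;
  otherwise the generator stays in front.\<close>

lemma first_index_mult_generator:
  assumes "w \<in> carrier (free_group A)" and "first_index w \<noteq> letter_index (False, i)"
  shows "first_index ([(True, i)] \<otimes>\<^bsub>free_group A\<^esub> w) = letter_index (True, i)"
proof -
  have "[(True, i)] \<otimes>\<^bsub>free_group A\<^esub> w = push_letter (True, i) w"
    using assms(1) reduce_append[of "[(True, i)]" w] by (simp add: free_group_def reduce_reduced)
  with assms(2) show ?thesis
    by (cases w) (auto simp: first_index_def)
qed

text \<open>The partition of the free group by first letters is pulled back to \<open>G\<close>
  along the equivariant map \<open>p\<close>, so its behaviour under the generators carries
  over.\<close>

lemma free_subgroup_configuration_pair:
  fixes n :: nat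
  assumes G: "finitely_generated_group G" and K: "subgroup K G"
    and free: "G\<lparr>carrier := K\<rparr> \<cong> free_group {1..n}"
  obtains k g E where "configuration_pair G (n + k) g (2 * n + 1) E"
    and "\<And>i x. \<lbrakk>i \<in> {1..n}; x \<in> carrier G; x \<notin> E (letter_index (False, i))\<rbrakk>
      \<Longrightarrow> g i \<otimes>\<^bsub>G\<^esub> x \<in> E (letter_index (True, i))"
proof -
  interpret group G using G by (simp add: finitely_generated_group_def)
  let ?F = "free_group {1..n}"
  have "?F \<cong> G\<lparr>carrier := K\<rparr>"
    using group.iso_sym[OF subgroup_imp_group[OF K] free] .
  then obtain \<phi> where \<phi>: "\<phi> \<in> iso ?F (G\<lparr>carrier := K\<rparr>)"
    by (auto simp: is_iso_def)
  obtain p where p: "p ` carrier G = carrier ?F"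
    and p_mult: "\<And>u x. \<lbrakk>u \<in> carrier ?F; x \<in> carrier G\<rbrakk> \<Longrightarrow> p (\<phi> u \<otimes>\<^bsub>G\<^esub> x) = u \<otimes>\<^bsub>?F\<^esub> p x"
    using equivariant_map_onto_subgroup[OF K group_free_group \<phi>] by blast
  obtain S where S: "finite S" "S \<subseteq> carrier G" "generate G S = carrier G"
    using G by (auto simp: finitely_generated_group_def)
  obtain s where "bij_betw s {1..card S} S"
    using ex_bij_betw_nat_finite_1[OF S(1)] by blast
  then have s: "s ` {1..card S} = S" by (simp add: bij_betw_def)
  \<comment> \<open>The basis of the free subgroup comes first, then a finite generating set of
    \<open>G\<close>, shifted by \<open>n\<close>, so that the whole tuple generates
    \<open>G\<close>.\<close>
  define g where "g i = (if i \<le> n then \<phi> [(True, i)] else s (i - n))" for i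
  define E where "E j = {x \<in> carrier G. first_index (p x) = j}" for j
  have gen: "[(True, i)] \<in> carrier ?F" if "i \<in> {1..n}" for i
    using that by (simp add: free_group_def reduced_Cons)
  have \<phi>_G: "\<phi> [(True, i)] \<in> carrier G" if "i \<in> {1..n}" for i
    using \<phi> gen[OF that] subgroup.subset[OF K] by (auto simp: iso_def hom_def)
  have s_G: "s i \<in> carrier G" if "i \<in> {1..card S}" for i
    using that s S(2) by blast
  have closed: "g ` {1..n + card S} \<subseteq> carrier G"
  proof (intro image_subsetI)
    fix i assume "i \<in> {1..n + card S}"
    then have "i \<in> {1..n} \<or> \<not> i \<le> n \<and> i - n \<in> {1..card S}" by auto
    then show "g i \<in> carrier G"
      using \<phi>_G[of i] s_G[of "i - n"] by (auto simp: g_def)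
  qed
  have "S \<subseteq> g ` {1..n + card S}"
  proof
    fix x assume "x \<in> S"
    then obtain i where "i \<in> {1..card S}" "x = s i" using s by blast
    then show "x \<in> g ` {1..n + card S}"
      by (intro image_eqI[of _ _ "n + i"]) (auto simp: g_def)
  qed
  then have "generate G (g ` {1..n + card S}) = carrier G"
    using mono_generate[of S] S(3) generate_incl[OF closed] by blast
  \<comment> \<open>Surjectivity of \<open>p\<close> enters here; the equality yields both that the
    blocks cover \<open>G\<close> and that none is empty.\<close>
  moreover have range: "(\<lambda>x. first_index (p x)) ` carrier G = {1..2 * n + 1}"
    unfolding first_index_range[symmetric] p[symmetric] image_image ..
  then have "(\<Union>j\<in>{1..2 * n + 1}. E j) = carrier G"
    by (simp add: E_def flip: range) blast
  moreover have "\<forall>j\<in>{1..2 * n + 1}. E j \<noteq> {}"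
    unfolding range[symmetric] E_def by blast
  moreover have "disjoint_family_on E {1..2 * n + 1}"
    by (auto simp: disjoint_family_on_def E_def)
  ultimately have "configuration_pair G (n + card S) g (2 * n + 1) E"
    using closed by (simp add: configuration_pair_def)
  moreover have "g i \<otimes>\<^bsub>G\<^esub> x \<in> E (letter_index (True, i))"
    if i: "i \<in> {1..n}" and x: "x \<in> carrier G" "x \<notin> E (letter_index (False, i))" for i x
  proof -
    have "first_index (p (\<phi> [(True, i)] \<otimes>\<^bsub>G\<^esub> x)) = letter_index (True, i)"
      unfolding p_mult[OF gen[OF i] x(1)]
      using x p by (intro first_index_mult_generator) (auto simp: E_def)
    then show ?thesis using \<phi>_G[OF i] i x by (simp add: E_def g_def)
  qed
  ultimately show ?thesis using that by blast
qed

section \<open>Transfer of the free subgroup from \<open>G\<close> to \<open>H\<close>\<close>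

lemma configuration_equivalent_free_subgroup:
  fixes n :: nat
  assumes G: "finitely_generated_group G" and H: "group H"
    and equiv: "configuration_equivalent G H"
    and K: "subgroup K G" "G\<lparr>carrier := K\<rparr> \<cong> free_group {1..n}"
  shows "\<exists>L. subgroup L H \<and> H\<lparr>carrier := L\<rparr> \<cong> free_group {1..n}"
proof -
  interpret G: group G using G by (simp add: finitely_generated_group_def)
  interpret H: group H by (rule H)
  let ?m = "2 * n + 1"
  obtain k g E where pair: "configuration_pair G (n + k) g ?m E"
    and move: "\<And>i x. \<lbrakk>i \<in> {1..n}; x \<in> carrier G; x \<notin> E (letter_index (False, i))\<rbrakk>
      \<Longrightarrow> g i \<otimes>\<^bsub>G\<^esub> x \<in> E (letter_index (True, i))"
    using free_subgroup_configuration_pair[OF G K] by blast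
  have "configurations G (n + k) g ?m E \<in> Con G"
    unfolding Con_def using pair by blast
  then have "configurations G (n + k) g ?m E \<in> Con H"
    using equiv by (simp add: configuration_equivalent_def)
  then obtain l h m F where "configurations G (n + k) g ?m E = configurations H l h m F"
    and "configuration_pair H l h m F"
    unfolding Con_def mem_Collect_eq by (elim exE conjE)
  moreover from this have "l = n + k" "m = ?m"
    using configurations_sizes_eq[OF G.is_group pair H] by blast+
  ultimately have eq: "configurations G (n + k) g ?m E = configurations H (n + k) h ?m F"
    and pairH: "configuration_pair H (n + k) h ?m F" by simp_all
  note E_unique = configuration_pair_block_unique[OF pair]
  note F_unique = configuration_pair_block_unique[OF pairH]
  have index: "letter_index a \<in> {1..?m}" "letter_index a \<noteq> 1" if "snd a \<in> {1..n}" for a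
    using that by (cases a; auto)+
  have moveH: "h i \<otimes>\<^bsub>H\<^esub> y \<in> F (letter_index (True, i))"
    if i: "i \<in> {1..n}" and y: "y \<in> carrier H" "y \<notin> F (letter_index (False, i))" for i y
  proof -
    obtain c where c: "c \<in> configurations H (n + k) h ?m F" "y \<in> F (c ! 0)"
      and cH: "h i \<otimes>\<^bsub>H\<^esub> y \<in> F (c ! i)"
      using configuration_exists[OF H pairH y(1)] i by (metis atLeastAtMost_iff trans_le_add1)
    have "c \<in> configurations G (n + k) g ?m E" using c(1) eq by simp
    then obtain x where x: "x \<in> E (c ! 0)" and cG: "g i \<otimes>\<^bsub>G\<^esub> x \<in> E (c ! i)"
      using i unfolding configurations_def by auto
    have range: "c ! 0 \<in> {1..?m}" "c ! i \<in> {1..?m}"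
      using configurations_nth[OF c(1)] i by auto
    have "x \<in> carrier G"
      using x range pair unfolding configuration_pair_def by blast
    moreover have "x \<notin> E (letter_index (False, i))"
      using E_unique[OF range(1) index(1) x, of "(False, i)"] i c(2) y(2) by auto
    ultimately have "g i \<otimes>\<^bsub>G\<^esub> x \<in> E (letter_index (True, i))" by (rule move[OF i])
    then have "c ! i = letter_index (True, i)"
      using E_unique[OF range(2) index(1) cG, of "(True, i)"] i by simp
    then show ?thesis using cH by simp
  qed
  \<comment> \<open>Block 1 belongs to no letter and is nonempty, so it provides the starting point
    for ping-pong in \<open>H\<close>.\<close>
  have one: "1 \<in> {1..?m}" by simp
  then obtain y where y: "y \<in> F 1" "y \<in> carrier H"
    using pairH unfolding configuration_pair_def by blast
  show ?thesis
  proof (rule H.ping_pong[where f = h and D = "\<lambda>a. F (letter_index a)" and y = y])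
    show "h ` {1..n} \<subseteq> carrier H"
      using pairH by (auto simp: configuration_pair_def)
    show "F (letter_index a) \<inter> F (letter_index b) = {}"
      if "snd a \<in> {1..n}" "snd b \<in> {1..n}" "a \<noteq> b" for a b
    proof (rule ccontr)
      assume "\<not> ?thesis"
      then have "letter_index a = letter_index b"
        using F_unique[OF index(1)[OF that(1)] index(1)[OF that(2)]] by blast
      then show False using injD[OF inj_letter_index] that(3) by blast
    qed
    show "y \<notin> F (letter_index a)" if "snd a \<in> {1..n}" for a
      using F_unique[OF one index(1)[OF that] y(1)] index(2)[OF that] by metis
  qed (use moveH y in auto)
qed

theorem theorem2p6:
  fixes G :: "('a, 'b) monoid_scheme" and H :: "('c, 'd) monoid_scheme" and n :: nat
  assumes "finitely_generated_group G" and "finitely_generated_group H"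
    and "configuration_equivalent G H"
    and "has_nonabelian_free_subgroup G n"
  shows "has_nonabelian_free_subgroup H n"
proof -
  have G: "group G" and H: "group H"
    using assms(1,2) by (simp_all add: finitely_generated_group_def)
  obtain K where K: "subgroup K G" "G\<lparr>carrier := K\<rparr> \<cong> free_group {1..n}"
    and nonabelian: "\<not> comm_group (G\<lparr>carrier := K\<rparr>)"
    using assms(4) by (auto simp: has_nonabelian_free_subgroup_def)
  obtain L where L: "subgroup L H" "H\<lparr>carrier := L\<rparr> \<cong> free_group {1..n}"
    using configuration_equivalent_free_subgroup[OF assms(1) H assms(3) K] by blast
  have groupK: "group (G\<lparr>carrier := K\<rparr>)"
    using G K(1) by (rule group.subgroup_imp_group)
  \<comment> \<open>Both subgroups are isomorphic to the same free group, so commutativity of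
    \<open>L\<close> would pass to \<open>K\<close>.\<close>
  have "H\<lparr>carrier := L\<rparr> \<cong> G\<lparr>carrier := K\<rparr>"
    using L(2) group.iso_sym[OF groupK K(2)] by (rule iso_trans)
  then have "\<not> comm_group (H\<lparr>carrier := L\<rparr>)"
    using comm_group.iso_imp_comm_group[OF _ _ group.is_monoid[OF groupK]] nonabelian by blast
  then show ?thesis
    using L by (auto simp: has_nonabelian_free_subgroup_def)
qed

end
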